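(* Let $S\in\mathsf{DS}$ and let $T$ be any semigroup. If $\alpha:T\to S$ is an epimorphism (of semigroups), then $\alpha$ is onto.
   Context: $\mathsf{DS}$ is the class of all finite semigroups in which every regular $\mathcal{D}$-class is a subsemigroup. A semigroup homomorphism $\alpha:T\to S$ is an epimorphism if, for all semigroups $R$ and all homomorphisms $\beta,\gamma:S\to R$, $\beta\circ\alpha=\gamma\circ\alpha$ implies $\beta=\gamma$. *)

theory Defs
  imports "HOL-Library.FuncSet" "HOL-Library.Countable_Set" "HOL-Library.Infinite_Typeclass"
begin

text \<open>A semigroup is given by a carrier set and a multiplication. The empty carrier is not
  excluded.\<close>

locale semigroup_on =
  fixes S :: "'a set" and f :: "'a \<Rightarrow> 'a \<Rightarrow> 'a"
  assumes closed: "x \<in> S \<Longrightarrow> y \<in> S \<Longrightarrow> f x y \<in> S"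
    and assoc: "x \<in> S \<Longrightarrow> y \<in> S \<Longrightarrow> z \<in> S \<Longrightarrow> f (f x y) z = f x (f y z)"

definition subsemigroup :: "'a set \<Rightarrow> 'a set \<Rightarrow> ('a \<Rightarrow> 'a \<Rightarrow> 'a) \<Rightarrow> bool" where
  "subsemigroup H S f \<longleftrightarrow> H \<noteq> {} \<and> H \<subseteq> S \<and> (\<forall>x\<in>H. \<forall>y\<in>H. f x y \<in> H)"

text \<open>The principal one-sided ideals \<open>S\<^sup>1 a\<close> and \<open>a S\<^sup>1\<close>, where \<open>S\<^sup>1\<close> is \<open>S\<close> with an identity adjoined.\<close>

definition left_principal :: "'a set \<Rightarrow> ('a \<Rightarrow> 'a \<Rightarrow> 'a) \<Rightarrow> 'a \<Rightarrow> 'a set" where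
  "left_principal S f a = insert a ((\<lambda>x. f x a) ` S)"

definition right_principal :: "'a set \<Rightarrow> ('a \<Rightarrow> 'a \<Rightarrow> 'a) \<Rightarrow> 'a \<Rightarrow> 'a set" where
  "right_principal S f a = insert a ((\<lambda>x. f a x) ` S)"

definition green_L :: "'a set \<Rightarrow> ('a \<Rightarrow> 'a \<Rightarrow> 'a) \<Rightarrow> 'a rel" where
  "green_L S f = {(a, b) \<in> S \<times> S. left_principal S f a = left_principal S f b}"

definition green_R :: "'a set \<Rightarrow> ('a \<Rightarrow> 'a \<Rightarrow> 'a) \<Rightarrow> 'a rel" where
  "green_R S f = {(a, b) \<in> S \<times> S. right_principal S f a = right_principal S f b}"

definition green_D :: "'a set \<Rightarrow> ('a \<Rightarrow> 'a \<Rightarrow> 'a) \<Rightarrow> 'a rel" where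
  "green_D S f = green_L S f O green_R S f"

definition regular_elem :: "'a set \<Rightarrow> ('a \<Rightarrow> 'a \<Rightarrow> 'a) \<Rightarrow> 'a \<Rightarrow> bool" where
  "regular_elem S f a \<longleftrightarrow> a \<in> S \<and> (\<exists>x\<in>S. f (f a x) a = a)"

definition regular_D_class :: "'a set \<Rightarrow> ('a \<Rightarrow> 'a \<Rightarrow> 'a) \<Rightarrow> 'a set \<Rightarrow> bool" where
  "regular_D_class S f D \<longleftrightarrow> D \<in> S // green_D S f \<and> (\<forall>a\<in>D. regular_elem S f a)"

definition DS :: "'a set \<Rightarrow> ('a \<Rightarrow> 'a \<Rightarrow> 'a) \<Rightarrow> bool" where
  "DS S f \<longleftrightarrow> semigroup_on S f \<and> finite S \<and>
     (\<forall>D. regular_D_class S f D \<longrightarrow> subsemigroup D S f)"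

definition semigroup_hom ::
    "'a set \<Rightarrow> ('a \<Rightarrow> 'a \<Rightarrow> 'a) \<Rightarrow> 'b set \<Rightarrow> ('b \<Rightarrow> 'b \<Rightarrow> 'b) \<Rightarrow> ('a \<Rightarrow> 'b) \<Rightarrow> bool" where
  "semigroup_hom S f R g h \<longleftrightarrow>
     h \<in> S \<rightarrow> R \<and> (\<forall>x\<in>S. \<forall>y\<in>S. h (f x y) = g (h x) (h y))"

text \<open>HOL cannot quantify over the type of the elements of \<open>R\<close> inside a formula, so the definition
  takes that type as a parameter. Lemma \<open>semigroup_epi_any_type\<close> below shows that, for
  countable \<open>S\<close>, every infinite choice of it gives the same notion, namely cancellation against
  semigroups \<open>R\<close> of arbitrary type. Homomorphisms are compared on their domain only,
  since their values elsewhere carry no information.\<close>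

definition semigroup_epi ::
    "'r itself \<Rightarrow> 't set \<Rightarrow> ('t \<Rightarrow> 't \<Rightarrow> 't) \<Rightarrow> 's set \<Rightarrow> ('s \<Rightarrow> 's \<Rightarrow> 's) \<Rightarrow> ('t \<Rightarrow> 's) \<Rightarrow> bool" where
  "semigroup_epi (_ :: 'r itself) T e S f \<alpha> \<longleftrightarrow>
     semigroup_hom T e S f \<alpha> \<and>
     (\<forall>(R :: 'r set) g \<beta> \<gamma>.
        semigroup_on R g \<longrightarrow> semigroup_hom S f R g \<beta> \<longrightarrow> semigroup_hom S f R g \<gamma> \<longrightarrow>
        (\<forall>t\<in>T. (\<beta> \<circ> \<alpha>) t = (\<gamma> \<circ> \<alpha>) t) \<longrightarrow> (\<forall>s\<in>S. \<beta> s = \<gamma> s))"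

inductive_set generated :: "('a \<Rightarrow> 'a \<Rightarrow> 'a) \<Rightarrow> 'a set \<Rightarrow> 'a set" for g A where
  gen: "a \<in> A \<Longrightarrow> a \<in> generated g A"
| mul: "x \<in> generated g A \<Longrightarrow> y \<in> generated g A \<Longrightarrow> g x y \<in> generated g A"

lemma generated_subset:
  assumes "semigroup_on R g" "A \<subseteq> R"
  shows "generated g A \<subseteq> R"
proof
  fix x assume "x \<in> generated g A"
  then show "x \<in> R"
    by induction (use assms in \<open>auto simp: semigroup_on_def\<close>)
qed

lemma countable_generated:
  assumes "semigroup_on R g" "A \<subseteq> R" "countable A"
  shows "countable (generated g A)"
proof -
  define F where "F = (\<lambda>p. foldr g (fst p) (snd p :: 'a))"
  have in_R: "F (as, a) \<in> R" if "as \<in> lists A" "a \<in> A" for as a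
    using that assms(1,2) by (induction as) (auto simp: F_def semigroup_on_def)
  have mult: "g (F (as, a)) (F (bs, b)) = F (as @ a # bs, b)"
    if "as \<in> lists A" "a \<in> A" "bs \<in> lists A" "b \<in> A" for as a bs b
    using that(1)
  proof (induction as)
    case Nil
    then show ?case by (simp add: F_def)
  next
    case (Cons c as)
    have "g (g c (F (as, a))) (F (bs, b)) = g c (g (F (as, a)) (F (bs, b)))"
      using Cons that in_R assms(1,2) by (intro semigroup_on.assoc[of R]) auto
    with Cons show ?case by (simp add: F_def)
  qed
  have "generated g A \<subseteq> F ` (lists A \<times> A)"
  proof
    fix x assume "x \<in> generated g A"
    then show "x \<in> F ` (lists A \<times> A)"
    proof induction
      case (gen a)
      have "a = F ([], a)" by (simp add: F_def)
      with gen show ?case by (intro image_eqI) auto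
    next
      case (mul x y)
      then obtain as a bs b where "x = F (as, a)" "y = F (bs, b)"
        "as \<in> lists A" "a \<in> A" "bs \<in> lists A" "b \<in> A" by auto
      with mult show ?case by (intro image_eqI[of _ _ "(as @ a # bs, b)"]) auto
    qed
  qed
  moreover have "countable (F ` (lists A \<times> A))"
    using assms(3) by (intro countable_image countable_SIGMA countable_lists)
  ultimately show ?thesis by (rule countable_subset)
qed

lemma semigroup_epi_any_type:
  fixes R :: "'q set" and \<alpha> :: "'t \<Rightarrow> 's"
  assumes epi: "semigroup_epi TYPE('r::infinite) T e S f \<alpha>" and S: "countable S"
  shows "semigroup_epi TYPE('q) T e S f \<alpha>"
  unfolding semigroup_epi_def
proof (intro conjI allI impI)
  show "semigroup_hom T e S f \<alpha>" using epi by (simp add: semigroup_epi_def)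
next
  fix R :: "'q set" and g and \<beta> \<gamma> :: "'s \<Rightarrow> 'q"
  assume R: "semigroup_on R g" and b: "semigroup_hom S f R g \<beta>"
    and c: "semigroup_hom S f R g \<gamma>" and eq: "\<forall>t\<in>T. (\<beta> \<circ> \<alpha>) t = (\<gamma> \<circ> \<alpha>) t"
  define A where "A = \<beta> ` S \<union> \<gamma> ` S"
  define Q where "Q = generated g A"
  have A: "A \<subseteq> R" "countable A"
    using b c S by (auto simp: A_def semigroup_hom_def)
  have QR: "Q \<subseteq> R" and cQ: "countable Q"
    using generated_subset[OF R A(1)] countable_generated[OF R A] by (auto simp: Q_def)
  have AQ: "A \<subseteq> Q" and Qm: "\<And>x y. x \<in> Q \<Longrightarrow> y \<in> Q \<Longrightarrow> g x y \<in> Q"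
    unfolding Q_def by (blast intro: gen, rule mul)
  obtain i :: "nat \<Rightarrow> 'r" where i: "inj i"
    using infinite_countable_subset[OF infinite_UNIV] by blast
  define h where "h = i \<circ> to_nat_on Q"
  have h: "inj_on h Q"
    unfolding h_def using cQ i by (intro comp_inj_on) (auto intro: inj_on_subset)
  define k where "k = inv_into Q h"
  have kh: "k (h x) = x" if "x \<in> Q" for x
    using h that by (simp add: k_def)
  define m where "m = (\<lambda>x y. h (g (k x) (k y)))"
  have sg: "semigroup_on (h ` Q) m"
  proof
    fix x y z assume "x \<in> h ` Q" "y \<in> h ` Q" "z \<in> h ` Q"
    then obtain x' y' z' where "x = h x'" "y = h y'" "z = h z'" "x' \<in> Q" "y' \<in> Q" "z' \<in> Q"
      by blast
    then show "m (m x y) z = m x (m y z)"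
      using R QR Qm by (simp add: m_def kh semigroup_on.assoc[OF R] subset_iff)
  qed (auto simp: m_def kh intro!: Qm)
  have Qbc: "\<beta> s \<in> Q" "\<gamma> s \<in> Q" if "s \<in> S" for s
    using AQ that by (auto simp: A_def)
  have "semigroup_hom S f (h ` Q) m (h \<circ> \<beta>)" "semigroup_hom S f (h ` Q) m (h \<circ> \<gamma>)"
    using b c Qbc by (auto simp: semigroup_hom_def m_def kh)
  moreover have "\<forall>t\<in>T. ((h \<circ> \<beta>) \<circ> \<alpha>) t = ((h \<circ> \<gamma>) \<circ> \<alpha>) t"
    using eq by simp
  ultimately have "\<forall>s\<in>S. (h \<circ> \<beta>) s = (h \<circ> \<gamma>) s"
    using epi sg unfolding semigroup_epi_def by blast
  then show "\<forall>s\<in>S. \<beta> s = \<gamma> s"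
    using Qbc h by (auto simp: inj_on_eq_iff)
qed

end

theory Submission imports Defs begin

text \<open>Let \<open>U\<close> be the image of an epimorphism into \<open>S\<close> and suppose \<open>U \<noteq> S\<close>. Take a \<open>\<J>\<close>-class \<open>J\<close>
  maximal among those not contained in \<open>U\<close>. If no product of two elements of \<open>J\<close> were in \<open>J\<close>,
  doubling \<open>J - U\<close> would give a semigroup with two homomorphisms from \<open>S\<close> that differ exactly
  there. So \<open>J\<close> is regular, hence a completely simple subsemigroup because \<open>S\<close> is in \<open>DS\<close>.
  Since \<open>U\<close>-equivariant maps between partial right \<open>S\<close>-acts are \<open>S\<close>-equivariant, two choices
  of such maps finish the argument. The first gives \<open>J = J (U \<inter> J)\<close>. The second, on the elements of
  \<open>S\<^sup>1\<close> that lie above \<open>J\<close>, fixes \<open>U\<close> and multiplies \<open>J - U\<close> on the left by some \<open>c \<in> J\<close>; it gives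
  \<open>c d = d\<close> for all \<open>d \<in> J - U\<close>. Choosing \<open>c \<in> U \<inter> J\<close> with \<open>d c = d\<close> then forces \<open>d = c\<close>.\<close>

section \<open>Stability and Green's relations in finite semigroups\<close>

text \<open>Along the \<open>h\<close>-orbit of \<open>v\<close>, \<open>g\<close> undoes one step
  of \<open>h\<close>. The orbit lies in a finite set, so it repeats, and powers of \<open>g\<close>
  move the repetition back to \<open>v\<close>.\<close>

lemma funpow_cycle:
  assumes "finite S" "v \<in> S" and h: "\<And>x. x \<in> S \<Longrightarrow> h x \<in> S"
    and comm: "\<And>x. x \<in> S \<Longrightarrow> g (h x) = h (g x)" and gh: "g (h v) = v"
  shows "\<exists>k. (g ^^ Suc k) v = v \<and> (h ^^ Suc k) v = v"
proof -
  have hS: "(h ^^ n) v \<in> S" for n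
    by (induction n) (use assms in auto)
  have step: "g ((h ^^ Suc n) v) = (h ^^ n) v" for n
  proof (induction n)
    case (Suc n)
    then show ?case using comm[OF hS, of "Suc n"] by simp
  qed (simp add: gh)
  have cancel: "(g ^^ n) ((h ^^ (n + m)) v) = (h ^^ m) v" for n m
  proof (induction n)
    case (Suc n)
    have "(g ^^ Suc n) ((h ^^ (Suc n + m)) v) = (g ^^ n) (g ((h ^^ Suc (n + m)) v))"
      by (simp only: funpow_Suc_right o_apply add_Suc)
    then show ?case by (simp only: step Suc)
  qed simp
  have "finite (range (\<lambda>n. (h ^^ n) v))"
    by (rule finite_subset[OF _ \<open>finite S\<close>]) (use hS in auto)
  then have "\<not> inj (\<lambda>n. (h ^^ n) v)"
    using finite_imageD infinite_UNIV_nat by blast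
  then obtain i j where "i < j" "(h ^^ i) v = (h ^^ j) v"
    unfolding inj_def by (metis nat_neq_iff)
  then obtain k where "(h ^^ i) v = (h ^^ (i + Suc k)) v"
    using less_imp_Suc_add by (metis add_Suc_right)
  then have "(h ^^ Suc k) v = v"
    using cancel[of i "Suc k"] cancel[of i 0] by simp
  moreover have "(g ^^ Suc k) ((h ^^ Suc k) v) = v"
    using cancel[of "Suc k" 0] by simp
  ultimately show ?thesis by metis
qed

locale finite_semigroup_on = semigroup_on S f
  for S :: "'a set" and f (infixl "\<cdot>" 70) +
  assumes finite_carrier: "finite S"
begin

text \<open>\<open>None\<close> is the adjoined identity of \<open>S\<^sup>1\<close>.\<close>

definition S1 :: "'a option set" where
  "S1 = insert None (Some ` S)"

definition mult1 :: "'a option \<Rightarrow> 'a option \<Rightarrow> 'a option" (infixl "\<odot>" 70) where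
  "p \<odot> q = (case p of None \<Rightarrow> q | Some x \<Rightarrow> (case q of None \<Rightarrow> p | Some y \<Rightarrow> Some (x \<cdot> y)))"

lemma mult1_simps [simp]:
  "None \<odot> q = q" "p \<odot> None = p" "Some x \<odot> Some y = Some (x \<cdot> y)"
  by (auto simp: mult1_def split: option.split)

lemma S1_simps [simp]: "None \<in> S1" "Some x \<in> S1 \<longleftrightarrow> x \<in> S"
  by (auto simp: S1_def)

lemma mult1_closed [simp]: "p \<in> S1 \<Longrightarrow> q \<in> S1 \<Longrightarrow> p \<odot> q \<in> S1"
  by (auto simp: S1_def closed)

lemma mult1_assoc: "p \<in> S1 \<Longrightarrow> q \<in> S1 \<Longrightarrow> r \<in> S1 \<Longrightarrow> p \<odot> q \<odot> r = p \<odot> (q \<odot> r)"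
  by (auto simp: S1_def assoc)

lemma finite_S1: "finite S1"
  by (simp add: S1_def finite_carrier)

definition J_le :: "'a option \<Rightarrow> 'a option \<Rightarrow> bool" (infix "\<preceq>" 50) where
  "p \<preceq> q \<longleftrightarrow> (\<exists>a\<in>S1. \<exists>b\<in>S1. p = a \<odot> q \<odot> b)"

lemma J_leI: "a \<in> S1 \<Longrightarrow> b \<in> S1 \<Longrightarrow> a \<odot> q \<odot> b \<preceq> q"
  by (auto simp: J_le_def)

lemma J_le_refl [simp]: "p \<preceq> p"
  using J_leI[of None None p] by simp

lemma J_le_trans:
  assumes "p \<preceq> q" "q \<preceq> r" "r \<in> S1"
  shows "p \<preceq> r"
proof -
  obtain a b c d where S1: "a \<in> S1" "b \<in> S1" "c \<in> S1" "d \<in> S1"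
    and "p = a \<odot> q \<odot> b" "q = c \<odot> r \<odot> d"
    using assms by (auto simp: J_le_def)
  then have "p = (a \<odot> c) \<odot> r \<odot> (d \<odot> b)"
    using assms by (simp add: mult1_assoc)
  with S1 show ?thesis by (simp add: J_leI)
qed

lemma J_le_mult_left: "p \<in> S1 \<Longrightarrow> p \<odot> q \<preceq> q"
  using J_leI[of p None q] by simp

lemma J_le_mult_right: "q \<in> S1 \<Longrightarrow> p \<odot> q \<preceq> p"
  using J_leI[of None q p] by simp

lemma J_le_mult: "x \<in> S \<Longrightarrow> Some (x \<cdot> y) \<preceq> Some y" "y \<in> S \<Longrightarrow> Some (x \<cdot> y) \<preceq> Some x"
  using J_le_mult_left[of "Some x" "Some y"] J_le_mult_right[of "Some y" "Some x"] by simp_all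

text \<open>Write \<open>v = a \<odot> (v \<odot> s) \<odot> b\<close>. Left translation by
  \<open>a\<close> and right translation by \<open>s \<odot> b\<close> commute and their composite
  fixes \<open>v\<close>, so a positive power of the right translation alone fixes \<open>v\<close>;
  that power starts with \<open>s\<close>.\<close>

lemma stable_right:
  assumes "v \<in> S1" "s \<in> S1" "v \<preceq> v \<odot> s"
  shows "\<exists>t\<in>S1. v \<odot> s \<odot> t = v"
proof -
  obtain a b where ab: "a \<in> S1" "b \<in> S1" "v = a \<odot> (v \<odot> s) \<odot> b"
    using assms(3) by (auto simp: J_le_def)
  let ?h = "\<lambda>x. x \<odot> (s \<odot> b)"
  obtain k where k: "(?h ^^ Suc k) v = v"
    using funpow_cycle[of S1 v ?h "\<lambda>x. a \<odot> x"] finite_S1 ab assms(1,2)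
    by (auto simp: mult1_assoc)
  have "\<exists>t\<in>S1. (?h ^^ Suc k) v = v \<odot> s \<odot> t" for k
  proof (induction k)
    case 0
    then show ?case using ab assms by (auto simp: mult1_assoc)
  next
    case (Suc k)
    then obtain t where "t \<in> S1" "(?h ^^ Suc k) v = v \<odot> s \<odot> t" by blast
    then show ?case using ab assms
      by (intro bexI[of _ "t \<odot> (s \<odot> b)"]) (auto simp: mult1_assoc)
  qed
  with k show ?thesis by metis
qed

lemma stable_left:
  assumes "v \<in> S1" "s \<in> S1" "v \<preceq> s \<odot> v"
  shows "\<exists>t\<in>S1. t \<odot> (s \<odot> v) = v"
proof -
  obtain a b where ab: "a \<in> S1" "b \<in> S1" "v = a \<odot> (s \<odot> v) \<odot> b"
    using assms(3) by (auto simp: J_le_def)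
  let ?h = "\<lambda>x. (a \<odot> s) \<odot> x"
  obtain k where k: "(?h ^^ Suc k) v = v"
    using funpow_cycle[of S1 v ?h "\<lambda>x. x \<odot> b"] finite_S1 ab assms(1,2)
    by (auto simp: mult1_assoc)
  have "\<exists>t\<in>S1. (?h ^^ Suc k) v = t \<odot> (s \<odot> v)" for k
  proof (induction k)
    case 0
    then show ?case using ab assms by (auto simp: mult1_assoc)
  next
    case (Suc k)
    then obtain t where "t \<in> S1" "(?h ^^ Suc k) v = t \<odot> (s \<odot> v)" by blast
    then show ?case using ab assms
      by (intro bexI[of _ "(a \<odot> s) \<odot> t"]) (auto simp: mult1_assoc)
  qed
  with k show ?thesis by metis
qed

text \<open>Stability gives \<open>x = x \<odot> q\<close> with \<open>q = y \<odot> t\<close>. Now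
  \<open>q\<close> is J-below \<open>x = x \<odot> q\<close>, so stability on the other side gives
  \<open>q = r \<odot> x\<close>.\<close>

lemma regular_if_mult_J:
  assumes "x \<in> S1" "y \<in> S1" "x \<preceq> x \<odot> y" "y \<preceq> x"
  shows "\<exists>r\<in>S1. x \<odot> r \<odot> x = x"
proof -
  obtain t where t: "t \<in> S1" "x \<odot> y \<odot> t = x"
    using stable_right assms by blast
  define q where "q = y \<odot> t"
  have q: "q \<in> S1" "x \<odot> q = x"
    using assms t by (auto simp: q_def mult1_assoc)
  have "q \<preceq> x"
    using J_le_trans[of q y x] J_le_mult_right[of t y] assms t by (simp add: q_def)
  then have "q \<preceq> x \<odot> q" by (simp add: q)
  then obtain r where "r \<in> S1" "r \<odot> x = q"
    using stable_left[of q x] q assms by auto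
  with q assms show ?thesis
    by (intro bexI[of _ r]) (auto simp: mult1_assoc)
qed

text \<open>If \<open>y = a \<odot> x \<odot> b\<close>, stability provides \<open>a'\<close> and
  \<open>b'\<close> that undo the two multiplications, and \<open>b' \<odot> r \<odot> a'\<close>
  serves for \<open>y\<close>.\<close>

lemma regular_J:
  assumes "x \<in> S1" "r \<in> S1" "x \<odot> r \<odot> x = x" "y \<preceq> x" "x \<preceq> y"
  shows "\<exists>r\<in>S1. y \<odot> r \<odot> y = y"
proof -
  obtain a b where ab: "a \<in> S1" "b \<in> S1" and y: "y = a \<odot> x \<odot> b"
    using assms(4) by (auto simp: J_le_def)
  have "x \<preceq> a \<odot> x"
    using J_le_trans[OF assms(5), of "a \<odot> x"] J_le_mult_right[of b "a \<odot> x"] ab assms y by simp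
  then obtain a' where a': "a' \<in> S1" "a' \<odot> (a \<odot> x) = x"
    using stable_left ab assms by blast
  have "x \<preceq> x \<odot> b"
    using J_le_trans[OF assms(5), of "x \<odot> b"] J_le_mult_left[of a "x \<odot> b"] ab assms y
    by (simp add: mult1_assoc)
  then obtain b' where b': "b' \<in> S1" "x \<odot> b \<odot> b' = x"
    using stable_right ab assms by blast
  have "y \<odot> (b' \<odot> r \<odot> a') \<odot> y = a \<odot> ((x \<odot> b \<odot> b') \<odot> r \<odot> (a' \<odot> (a \<odot> x))) \<odot> b"
    using ab a'(1) b'(1) assms by (simp add: y mult1_assoc)
  also have "\<dots> = y"
    using a' b' assms y by simp
  finally show ?thesis using a' b' assms by (intro bexI[of _ "b' \<odot> r \<odot> a'"]) auto
qed

definition J_class :: "'a \<Rightarrow> 'a set" where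
  "J_class d = {x \<in> S. Some x \<preceq> Some d \<and> Some d \<preceq> Some x}"

lemma left_principal_iff: "x \<in> left_principal S f y \<longleftrightarrow> (\<exists>a\<in>S1. Some x = a \<odot> Some y)"
  by (auto simp: left_principal_def S1_def)

lemma right_principal_iff: "x \<in> right_principal S f y \<longleftrightarrow> (\<exists>a\<in>S1. Some x = Some y \<odot> a)"
  by (auto simp: right_principal_def S1_def)

lemma green_L_iff:
  "(x, y) \<in> green_L S f \<longleftrightarrow> x \<in> S \<and> y \<in> S \<and>
     (\<exists>a\<in>S1. Some x = a \<odot> Some y) \<and> (\<exists>a\<in>S1. Some y = a \<odot> Some x)" (is "?l \<longleftrightarrow> ?r")
proof
  assume l: ?l
  then have "left_principal S f x = left_principal S f y" by (simp add: green_L_def)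
  moreover have "z \<in> left_principal S f z" for z by (simp add: left_principal_def)
  ultimately show ?r using l by (auto simp: green_L_def simp flip: left_principal_iff)
next
  assume r: ?r
  have "left_principal S f x \<subseteq> left_principal S f y" if "y \<in> S" "\<exists>a\<in>S1. Some x = a \<odot> Some y" for x y
    using that by (auto simp: left_principal_iff mult1_assoc[symmetric]
      intro!: bexI[of _ "_ \<odot> _"])
  with r show ?l by (auto simp: green_L_def)
qed

lemma green_R_iff:
  "(x, y) \<in> green_R S f \<longleftrightarrow> x \<in> S \<and> y \<in> S \<and>
     (\<exists>a\<in>S1. Some x = Some y \<odot> a) \<and> (\<exists>a\<in>S1. Some y = Some x \<odot> a)" (is "?l \<longleftrightarrow> ?r")
proof
  assume l: ?l
  then have "right_principal S f x = right_principal S f y" by (simp add: green_R_def)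
  moreover have "z \<in> right_principal S f z" for z by (simp add: right_principal_def)
  ultimately show ?r using l by (auto simp: green_R_def simp flip: right_principal_iff)
next
  assume r: ?r
  have "right_principal S f x \<subseteq> right_principal S f y" if "y \<in> S" "\<exists>a\<in>S1. Some x = Some y \<odot> a" for x y
    using that by (auto simp: right_principal_iff mult1_assoc intro!: bexI[of _ "_ \<odot> _"])
  with r show ?l by (auto simp: green_R_def)
qed

text \<open>If \<open>x\<close> is the product of \<open>a\<close>, \<open>d\<close>,
  \<open>b\<close>, then by stability \<open>c = a d\<close> is L-related to \<open>d\<close> and
  R-related to \<open>x\<close>.\<close>

lemma green_D_eq_J:
  assumes "d \<in> S"
  shows "green_D S f `` {d} = J_class d"
proof (intro equalityI subsetI)
  fix x assume "x \<in> green_D S f `` {d}"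
  then obtain c where c: "(d, c) \<in> green_L S f" "(c, x) \<in> green_R S f"
    by (auto simp: green_D_def)
  then have S: "c \<in> S" "x \<in> S" by (auto simp: green_L_iff green_R_iff)
  have "Some d \<preceq> Some c" "Some c \<preceq> Some d"
    using c(1) J_le_mult_left unfolding green_L_iff by metis+
  moreover have "Some x \<preceq> Some c" "Some c \<preceq> Some x"
    using c(2) J_le_mult_right unfolding green_R_iff by metis+
  ultimately show "x \<in> J_class d"
    using S assms J_le_trans unfolding J_class_def by (metis (mono_tags) S1_simps(2) mem_Collect_eq)
next
  fix x assume "x \<in> J_class d"
  then have x: "x \<in> S" "Some x \<preceq> Some d" "Some d \<preceq> Some x" by (auto simp: J_class_def)
  then obtain a b where ab: "a \<in> S1" "b \<in> S1" and xd: "Some x = a \<odot> Some d \<odot> b"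
    by (auto simp: J_le_def)
  obtain c where c: "Some c = a \<odot> Some d" "c \<in> S"
    using ab(1) assms by (auto simp: S1_def closed)
  have xc: "Some x = Some c \<odot> b" by (simp add: c xd)
  have "Some x \<preceq> Some c" "Some c \<preceq> Some d"
    using xc c J_le_mult_left J_le_mult_right ab by metis+
  then have "Some c \<preceq> Some c \<odot> b" "Some d \<preceq> a \<odot> Some d"
    using x J_le_trans assms c xc by (metis S1_simps(2))+
  then obtain a' b' where "a' \<in> S1" "a' \<odot> (a \<odot> Some d) = Some d" "b' \<in> S1" "Some c \<odot> b \<odot> b' = Some c"
    using stable_left stable_right ab c assms by (metis S1_simps(2))
  then have "(d, c) \<in> green_L S f" "(c, x) \<in> green_R S f"
    unfolding green_L_iff green_R_iff using ab assms c x xc by metis+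
  then show "x \<in> green_D S f `` {d}" by (auto simp: green_D_def)
qed

lemma regular_elem_iff: "regular_elem S f x \<longleftrightarrow> x \<in> S \<and> (\<exists>r\<in>S1. Some x \<odot> r \<odot> Some x = Some x)"
  by (auto simp: regular_elem_def S1_def) metis

lemma regular_J_class:
  assumes "d \<in> S" "x \<in> J_class d" "y \<in> J_class d" "x \<cdot> y \<in> J_class d"
  shows "regular_D_class S f (J_class d)"
proof -
  have S: "Some x \<in> S1" "Some y \<in> S1" "Some d \<in> S1" "Some (x \<cdot> y) \<in> S1"
    using assms by (auto simp: J_class_def closed)
  have eq: "Some u \<preceq> Some v" if "u \<in> J_class d" "v \<in> J_class d" for u v
    using that S J_le_trans unfolding J_class_def by (metis (mono_tags) S1_simps(2) mem_Collect_eq)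
  obtain r where r: "r \<in> S1" "Some x \<odot> r \<odot> Some x = Some x"
    using regular_if_mult_J[OF S(1,2)] eq[OF assms(2,4)] eq[OF assms(3,2)] by auto
  have "regular_elem S f z" if "z \<in> J_class d" for z
    using regular_J[OF S(1) r eq[OF that assms(2)] eq[OF assms(2) that]] that
    by (simp add: regular_elem_iff J_class_def)
  moreover have "J_class d \<in> S // green_D S f"
    using green_D_eq_J[OF assms(1)] assms(1) by (metis quotientI)
  ultimately show ?thesis by (simp add: regular_D_class_def)
qed

end

section \<open>Equivariant maps between partial acts\<close>

definition map_vimage :: "('x \<rightharpoonup> 'y) \<Rightarrow> 'y set \<Rightarrow> 'x set" where
  "map_vimage m A = {x. \<exists>y\<in>A. m x = Some y}"

lemma map_vimage_comp: "map_vimage (m \<circ>\<^sub>m n) A = map_vimage n (map_vimage m A)"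
  by (auto simp: map_vimage_def map_comp_def split: option.splits)

text \<open>Power sets under symmetric difference are vector spaces over the two-element field, and
  taking preimages is linear.\<close>

lemma map_vimage_sym_diff:
  "map_vimage m (sym_diff A B) = sym_diff (map_vimage m A) (map_vimage m B)"
  by (auto simp: map_vimage_def)

lemma map_vimage_empty [simp]: "map_vimage m {} = {}"
  by (simp add: map_vimage_def)

lemma map_vimage_inject:
  assumes "\<And>A. map_vimage m A = map_vimage n A"
  shows "m = n"
proof
  fix x
  have "m x = Some y \<longleftrightarrow> n x = Some y" for y
    using assms[of "{y}"] by (auto simp: map_vimage_def)
  then show "m x = n x" by (metis not_Some_eq)
qed

text \<open>Taking preimages turns partial right acts into left acts on power sets, and conjugation by
  the involution \<open>\<tau>\<close> below fixes the action of \<open>s\<close> iff \<open>\<phi>\<close> commutes with \<open>s\<close>.\<close>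

lemma epi_equivariant:
  fixes X :: "'s \<Rightarrow> 'x \<rightharpoonup> 'x" and Z :: "'s \<Rightarrow> 'z \<rightharpoonup> 'z" and \<phi> :: "'x \<rightharpoonup> 'z"
  assumes epi: "semigroup_epi TYPE('r::infinite) T e S f \<alpha>" and S: "countable S"
    and X: "\<And>s t. s \<in> S \<Longrightarrow> t \<in> S \<Longrightarrow> X (f s t) = X t \<circ>\<^sub>m X s"
    and Z: "\<And>s t. s \<in> S \<Longrightarrow> t \<in> S \<Longrightarrow> Z (f s t) = Z t \<circ>\<^sub>m Z s"
    and \<phi>: "\<And>u. u \<in> \<alpha> ` T \<Longrightarrow> \<phi> \<circ>\<^sub>m X u = Z u \<circ>\<^sub>m \<phi>"
    and s: "s \<in> S"
  shows "\<phi> \<circ>\<^sub>m X s = Z s \<circ>\<^sub>m \<phi>"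
proof -
  define \<beta> where "\<beta> s = (\<lambda>(A, B). (map_vimage (X s) A, map_vimage (Z s) B))" for s
  \<comment> \<open>A shear: it adds the \<open>\<phi>\<close>-preimage of the second component to
    the first, and is its own inverse in characteristic two.\<close>
  define \<tau> where "\<tau> = (\<lambda>(A, B). (sym_diff A (map_vimage \<phi> B), B))"
  define \<gamma> where "\<gamma> s = \<tau> \<circ> \<beta> s \<circ> \<tau>" for s
  have \<tau>\<tau>: "\<tau> (\<tau> p) = p" for p
    by (cases p) (auto simp: \<tau>_def)
  have \<beta>: "\<beta> (f s t) = \<beta> s \<circ> \<beta> t" if "s \<in> S" "t \<in> S" for s t
    using that by (auto simp: \<beta>_def X Z map_vimage_comp)
  have comm: "\<tau> \<circ> \<beta> s = \<beta> s \<circ> \<tau> \<longleftrightarrow> \<phi> \<circ>\<^sub>m X s = Z s \<circ>\<^sub>m \<phi>" for s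
  proof
    assume "\<tau> \<circ> \<beta> s = \<beta> s \<circ> \<tau>"
    \<comment> \<open>An empty first component isolates the contribution of
      \<open>\<phi>\<close>.\<close>
    then have "(\<tau> \<circ> \<beta> s) ({}, B) = (\<beta> s \<circ> \<tau>) ({}, B)" for B by simp
    then show "\<phi> \<circ>\<^sub>m X s = Z s \<circ>\<^sub>m \<phi>"
      by (intro map_vimage_inject) (auto simp: \<tau>_def \<beta>_def map_vimage_comp map_vimage_sym_diff)
  next
    assume *: "\<phi> \<circ>\<^sub>m X s = Z s \<circ>\<^sub>m \<phi>"
    have "map_vimage (X s) (map_vimage \<phi> B) = map_vimage \<phi> (map_vimage (Z s) B)" for B
      by (metis * map_vimage_comp)
    then show "\<tau> \<circ> \<beta> s = \<beta> s \<circ> \<tau>"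
      by (auto simp: \<tau>_def \<beta>_def map_vimage_sym_diff fun_eq_iff)
  qed
  have "semigroup_epi TYPE('x set \<times> 'z set \<Rightarrow> 'x set \<times> 'z set) T e S f \<alpha>"
    using semigroup_epi_any_type[OF epi S] .
  moreover have "semigroup_on UNIV ((\<circ>) :: ('x set \<times> 'z set \<Rightarrow> 'x set \<times> 'z set) \<Rightarrow> _)"
    by standard (auto simp: fun_eq_iff)
  moreover have "semigroup_hom S f UNIV (\<circ>) \<beta>" "semigroup_hom S f UNIV (\<circ>) \<gamma>"
    by (auto simp: semigroup_hom_def \<beta> \<gamma>_def fun_eq_iff \<tau>\<tau>)
  moreover have "\<forall>t\<in>T. (\<beta> \<circ> \<alpha>) t = (\<gamma> \<circ> \<alpha>) t"
  proof
    fix t assume "t \<in> T"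
    then have "\<tau> \<circ> \<beta> (\<alpha> t) = \<beta> (\<alpha> t) \<circ> \<tau>" using comm \<phi> by blast
    then have "\<gamma> (\<alpha> t) = \<beta> (\<alpha> t) \<circ> (\<tau> \<circ> \<tau>)" by (simp add: \<gamma>_def comp_assoc)
    then show "(\<beta> \<circ> \<alpha>) t = (\<gamma> \<circ> \<alpha>) t" by (simp add: fun_eq_iff \<tau>\<tau>)
  qed
  ultimately have "\<forall>s\<in>S. \<beta> s = \<gamma> s"
    unfolding semigroup_epi_def by blast
  then have "\<beta> s = \<tau> \<circ> \<beta> s \<circ> \<tau>" using s \<gamma>_def by simp
  then have "\<tau> \<circ> \<beta> s = \<beta> s \<circ> \<tau>" by (metis \<tau>\<tau> comp_apply ext)
  then show ?thesis by (simp add: comm)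
qed

section \<open>The maximal J-class not contained in the image\<close>

locale maximal_missing_J_class = finite_semigroup_on S f
  for S :: "'a set" and f (infixl "\<cdot>" 70) +
  fixes T :: "'t set" and e :: "'t \<Rightarrow> 't \<Rightarrow> 't" and \<alpha> :: "'t \<Rightarrow> 'a" and d :: 'a
  assumes DS: "DS S f"
    and T: "semigroup_on T e"
    and epi: "semigroup_epi TYPE(nat) T e S f \<alpha>"
    and d: "d \<in> S" "d \<notin> \<alpha> ` T"
    and d_max: "y \<in> S \<Longrightarrow> y \<notin> \<alpha> ` T \<Longrightarrow> Some d \<preceq> Some y \<Longrightarrow> Some y \<preceq> Some d"
begin

definition "U = \<alpha> ` T"

abbreviation "J \<equiv> J_class d"

lemma hom: "semigroup_hom T e S f \<alpha>"
  using epi by (simp add: semigroup_epi_def)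

lemma U_in_S: "u \<in> U \<Longrightarrow> u \<in> S"
  using hom by (auto simp: semigroup_hom_def U_def)

lemma U_closed:
  assumes "u \<in> U" "v \<in> U"
  shows "u \<cdot> v \<in> U"
proof -
  obtain s t where "s \<in> T" "t \<in> T" "u = \<alpha> s" "v = \<alpha> t" using assms by (auto simp: U_def)
  then show ?thesis
    using hom semigroup_on.closed[OF T, of s t] unfolding semigroup_hom_def U_def
    by (metis imageI)
qed

lemma equivariant:
  fixes X :: "'a \<Rightarrow> 'x \<rightharpoonup> 'x" and Z :: "'a \<Rightarrow> 'z \<rightharpoonup> 'z"
  assumes "\<And>s t. s \<in> S \<Longrightarrow> t \<in> S \<Longrightarrow> X (s \<cdot> t) = X t \<circ>\<^sub>m X s"
    and "\<And>s t. s \<in> S \<Longrightarrow> t \<in> S \<Longrightarrow> Z (s \<cdot> t) = Z t \<circ>\<^sub>m Z s"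
    and "\<And>u. u \<in> U \<Longrightarrow> \<phi> \<circ>\<^sub>m X u = Z u \<circ>\<^sub>m \<phi>"
    and "s \<in> S"
  shows "\<phi> \<circ>\<^sub>m X s = Z s \<circ>\<^sub>m \<phi>"
  by (rule epi_equivariant[OF epi countable_finite[OF finite_carrier]]) (use assms in \<open>auto simp: U_def\<close>)

lemma J_in_S: "x \<in> J \<Longrightarrow> x \<in> S"
  by (simp add: J_class_def)

lemma d_in_J: "d \<in> J"
  using d by (simp add: J_class_def)

lemma J_le_J: "x \<in> J \<Longrightarrow> y \<in> J \<Longrightarrow> Some x \<preceq> Some y"
  using J_le_trans[of "Some x" "Some d" "Some y"] by (simp add: J_class_def)

lemma J_convex:
  assumes "z \<in> J" "x \<in> J" "y \<in> S" "Some z \<preceq> Some y" "Some y \<preceq> Some x"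
  shows "y \<in> J"
  using assms J_le_trans[of "Some d" "Some z" "Some y"] J_le_trans[of "Some y" "Some x" "Some d"]
  by (auto simp: J_class_def d)

text \<open>The maximality of \<open>d\<close> is used only through this fact.\<close>

lemma above_J:
  assumes "z \<in> J" "y \<in> S" "Some z \<preceq> Some y"
  shows "y \<in> U \<or> y \<in> J"
  using assms d_max[of y] J_le_trans[of "Some d" "Some z" "Some y"]
  by (auto simp: J_class_def U_def)

text \<open>The partial product is squeezed between the full product and whichever factor lies in
  \<open>J\<close>.\<close>

lemma J_prefix: "x \<in> J \<or> s \<in> J \<Longrightarrow> x \<in> S \<Longrightarrow> s \<in> S \<Longrightarrow> t \<in> S \<Longrightarrow> x \<cdot> s \<cdot> t \<in> J \<Longrightarrow> x \<cdot> s \<in> J"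
  using J_convex[of "x \<cdot> s \<cdot> t" _ "x \<cdot> s"] J_le_mult closed by metis

lemma J_suffix: "s \<in> J \<or> t \<in> J \<Longrightarrow> x \<in> S \<Longrightarrow> s \<in> S \<Longrightarrow> t \<in> S \<Longrightarrow> x \<cdot> s \<cdot> t \<in> J \<Longrightarrow> s \<cdot> t \<in> J"
  using J_convex[of "x \<cdot> s \<cdot> t" _ "s \<cdot> t"] J_le_mult closed assoc by metis

lemma J_factors:
  assumes "x \<in> S" "y \<in> S" "x \<cdot> y \<in> J"
  shows "x \<in> U \<or> x \<in> J" "y \<in> U \<or> y \<in> J"
  using assms above_J J_le_mult by metis+

lemma J_not_null: "\<exists>x\<in>J. \<exists>y\<in>J. x \<cdot> y \<in> J"
proof (rule ccontr)
  assume null: "\<not> ?thesis"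
  define D where "D = J - U"
  \<comment> \<open>Associativity of \<open>g\<close> below needs this: a flag must not be lost in
    one bracketing only. If \<open>v\<close> were in \<open>J\<close>, \<open>null\<close> would
    fail; so \<open>v\<close> is in \<open>U\<close>, and \<open>s \<cdot> t\<close> in
    \<open>U\<close> would put the full product into \<open>U\<close>.\<close>
  have prefix: "s \<cdot> t \<in> D" if "s \<in> D \<or> t \<in> D" "s \<cdot> t \<cdot> v \<in> D" "s \<in> S" "t \<in> S" "v \<in> S" for s t v
  proof -
    have "s \<cdot> t \<in> J" using that J_prefix[of s t v] by (auto simp: D_def)
    moreover have "v \<in> U"
      using null calculation J_factors[of "s \<cdot> t" v] that by (auto simp: D_def closed)
    ultimately show ?thesis using U_closed that by (auto simp: D_def)
  qed
  have suffix: "t \<cdot> v \<in> D" if "t \<in> D \<or> v \<in> D" "s \<cdot> t \<cdot> v \<in> D" "s \<in> S" "t \<in> S" "v \<in> S" for s t v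
  proof -
    have "t \<cdot> v \<in> J" using that J_suffix[of t v s] by (auto simp: D_def)
    moreover have "s \<in> U"
      using null calculation J_factors[of s "t \<cdot> v"] that by (auto simp: D_def closed assoc)
    ultimately show ?thesis using U_closed that by (auto simp: D_def assoc)
  qed
  define R where "R = {(s, b). s \<in> S \<and> (b \<longrightarrow> s \<in> D)}"
  \<comment> \<open>A product lands in the second copy of \<open>D\<close> iff it lies in
    \<open>D\<close> and some factor is in that copy.\<close>
  define g where "g = (\<lambda>(s, b) (t, c). (s \<cdot> t, (b \<or> c) \<and> s \<cdot> t \<in> D))"
  have "semigroup_on R g"
  proof
    fix p q r assume "p \<in> R" "q \<in> R" "r \<in> R"
    then obtain s a t b v c where eqs: "p = (s, a)" "q = (t, b)" "r = (v, c)"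
      and S: "s \<in> S" "t \<in> S" "v \<in> S"
      and D: "a \<longrightarrow> s \<in> D" "b \<longrightarrow> t \<in> D" "c \<longrightarrow> v \<in> D"
      by (auto simp: R_def)
    then show "g (g p q) r = g p (g q r)"
      using prefix[of s t v] suffix[of t v s] by (auto simp: g_def assoc)
  qed (auto simp: R_def g_def closed)
  moreover have "semigroup_hom S f R g (\<lambda>s. (s, False))"
    by (auto simp: semigroup_hom_def R_def g_def)
  moreover have "semigroup_hom S f R g (\<lambda>s. (s, s \<in> D))"
  proof -
    have "s \<in> D \<or> t \<in> D" if "s \<in> S" "t \<in> S" "s \<cdot> t \<in> D" for s t
      using that J_factors[of s t] U_closed[of s t] by (auto simp: D_def)
    then show ?thesis by (auto simp: semigroup_hom_def R_def g_def)
  qed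
  moreover have "semigroup_epi TYPE('a \<times> bool) T e S f \<alpha>"
    using semigroup_epi_any_type[OF epi countable_finite[OF finite_carrier]] .
  moreover have "\<forall>t\<in>T. ((\<lambda>s. (s, False)) \<circ> \<alpha>) t = ((\<lambda>s. (s, s \<in> D)) \<circ> \<alpha>) t"
    by (auto simp: D_def U_def)
  ultimately have "\<forall>s\<in>S. (s, False) = (s, s \<in> D)"
    unfolding semigroup_epi_def by blast
  then show False using d d_in_J by (auto simp: D_def U_def)
qed

lemma J_regular: "regular_D_class S f J"
  using J_not_null regular_J_class d(1) by blast

text \<open>Here closure of the regular D-classes enters.\<close>

lemma J_closed: "x \<in> J \<Longrightarrow> y \<in> J \<Longrightarrow> x \<cdot> y \<in> J"
  using DS J_regular by (auto simp: DS_def subsemigroup_def)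

lemma J_left_unit:
  assumes "y \<in> J"
  shows "\<exists>x\<in>J. x \<cdot> y = y"
proof -
  obtain r where "r \<in> S" "y \<cdot> r \<cdot> y = y"
    using J_regular assms by (auto simp: regular_D_class_def regular_elem_def)
  then show ?thesis
    using J_prefix[of y r y] assms J_in_S by metis
qed

lemma J_cancel_right:
  assumes "v \<in> J" "s \<in> S" "v \<cdot> s \<in> J"
  shows "\<exists>t\<in>S1. Some (v \<cdot> s) \<odot> t = Some v"
  using stable_right[of "Some v" "Some s"] assms J_le_J[of v "v \<cdot> s"] by (auto simp: J_in_S)

text \<open>In a finite completely simple semigroup \<open>v u v\<close> lies in the maximal subgroup of \<open>v\<close>, so
  a power of \<open>v u\<close> fixes \<open>v\<close>.\<close>

lemma U_cancel_right:
  assumes "v \<in> U" "v \<in> J" "u \<in> U" "v \<cdot> u \<in> J"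
  shows "\<exists>w\<in>U. v \<cdot> u \<cdot> w = v"
proof -
  have S: "v \<in> S" "u \<in> S" using assms U_in_S by auto
  have "v \<cdot> (u \<cdot> v) \<in> J"
    using J_closed[OF assms(4,2)] S by (simp add: assoc)
  then obtain t where t: "t \<in> S1" "Some (v \<cdot> (u \<cdot> v)) \<odot> t = Some v"
    using J_cancel_right[of v "u \<cdot> v"] assms S closed by blast
  \<comment> \<open>The element \<open>t\<close> need not come from \<open>U\<close>. Left
    translation by \<open>v \<cdot> u\<close> commutes with right translation by \<open>t\<close>,
    and its iterates keep \<open>v\<close> inside \<open>U\<close>.\<close>
  let ?g = "\<lambda>x. Some (v \<cdot> u) \<odot> x"
  have "Some (v \<cdot> (u \<cdot> v)) = ?g (Some v)" using S by (simp add: assoc)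
  then have "?g (Some v \<odot> t) = Some v"
    using t S by (simp add: closed flip: mult1_assoc)
  then obtain k where k: "(?g ^^ Suc k) (Some v) = Some v"
    using funpow_cycle[of S1 "Some v" "\<lambda>x. x \<odot> t" ?g] finite_S1 S t(1)
    by (auto simp: mult1_assoc closed)
  have "\<exists>w\<in>U. (?g ^^ k) (Some v) = Some w" for k
    by (induction k) (use assms in \<open>auto intro!: U_closed\<close>)
  then obtain w where "w \<in> U" "(?g ^^ k) (Some v) = Some w" by blast
  with k show ?thesis by auto
qed

section \<open>Two applications of equivariance\<close>

lemma J_eq_J_mult_U:
  assumes y: "y \<in> J"
  shows "\<exists>x\<in>J. \<exists>u\<in>U \<inter> J. y = x \<cdot> u"
proof (rule ccontr)
  assume *: "\<not> ?thesis"
  define L where "L = {x \<cdot> u | x u. x \<in> J \<and> u \<in> U \<inter> J}"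
  have y_L: "y \<notin> L" using * by (auto simp: L_def)
  have L_mult: "x \<cdot> u \<in> L" if "x \<in> L" "u \<in> U" "x \<cdot> u \<in> J" for x u
  proof -
    obtain z v where zv: "x = z \<cdot> v" "z \<in> J" "v \<in> U" "v \<in> J" using \<open>x \<in> L\<close> by (auto simp: L_def)
    then have "v \<cdot> u \<in> J" using J_suffix[of v u z] that by (auto simp: J_in_S U_in_S)
    moreover have "x \<cdot> u = z \<cdot> (v \<cdot> u)" using zv that by (simp add: assoc J_in_S U_in_S)
    ultimately show ?thesis using zv that U_closed unfolding L_def by blast
  qed
  \<comment> \<open>\<open>X\<close> is the right act \<open>J\<close> with the part outside \<open>L\<close> doubled; elements outside \<open>U\<close> map into the
    copy \<open>False\<close>, and \<open>\<phi>\<close> swaps the two copies.\<close>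
  define X where "X s = (\<lambda>(x, i). if x \<in> J \<and> x \<cdot> s \<in> J
    then Some (x \<cdot> s, x \<cdot> s \<notin> L \<and> i \<and> s \<in> U) else None)" for s
  define \<phi> where "\<phi> = (\<lambda>(x, i). Some (x, i \<noteq> (x \<notin> L)))"
  \<comment> \<open>This makes \<open>X\<close> multiplicative. If \<open>s \<cdot> t\<close> is in
    \<open>U\<close>, it is not in \<open>J\<close>, since otherwise
    \<open>x \<cdot> s \<cdot> t\<close> would be in \<open>L\<close>; hence neither factor is in
    \<open>J\<close>, and both lie in \<open>U\<close>.\<close>
  have flag: "s \<cdot> t \<in> U \<longleftrightarrow> x \<cdot> s \<notin> L \<and> s \<in> U \<and> t \<in> U"
    if x: "x \<in> J" "x \<cdot> s \<cdot> t \<in> J" "x \<cdot> s \<cdot> t \<notin> L" and st: "s \<in> S" "t \<in> S" for x s t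
  proof
    assume U: "s \<cdot> t \<in> U"
    have S: "x \<in> S" using x J_in_S by auto
    have not_J: "s \<cdot> t \<notin> J" using x U st S by (auto simp: L_def assoc)
    then have "s \<notin> J" "t \<notin> J" using J_suffix[of s t x] x st S by auto
    then have "s \<in> U" "t \<in> U"
      using J_factors[of "x \<cdot> s" t] J_factors[of x s] J_prefix[of x s t] x st S by (auto simp: closed)
    then show "x \<cdot> s \<notin> L \<and> s \<in> U \<and> t \<in> U"
      using L_mult[of "x \<cdot> s" t] x by auto
  qed (simp add: U_closed)
  have X: "X (s \<cdot> t) = X t \<circ>\<^sub>m X s" if st: "s \<in> S" "t \<in> S" for s t
  proof
    fix p :: "'a \<times> bool"
    obtain x i where p: "p = (x, i)" by (cases p)
    show "X (s \<cdot> t) p = (X t \<circ>\<^sub>m X s) p"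
    proof (cases "x \<in> J \<and> x \<cdot> s \<cdot> t \<in> J")
      case True
      then have "x \<cdot> s \<in> J" using J_prefix[of x s t] st by (auto simp: J_in_S)
      with True show ?thesis
        using flag[of x s t] st by (auto simp: X_def p map_comp_def assoc J_in_S)
    next
      case False
      then show ?thesis using st by (auto simp: X_def p map_comp_def assoc J_in_S)
    qed
  qed
  have "\<phi> \<circ>\<^sub>m X u = X u \<circ>\<^sub>m \<phi>" if u: "u \<in> U" for u
    using L_mult u by (fastforce simp: X_def \<phi>_def map_comp_def fun_eq_iff)
  then have eq: "\<phi> \<circ>\<^sub>m X y = X y \<circ>\<^sub>m \<phi>"
    using equivariant[of X X \<phi> y] X y J_in_S by blast
  obtain x where x: "x \<in> J" "x \<cdot> y = y" using J_left_unit y by blast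
  then have "y \<notin> U" using y y_L by (force simp: L_def)
  \<comment> \<open>As \<open>y\<close> is outside \<open>U\<close>, it sends both copies of
    \<open>x\<close> to \<open>(y, False)\<close>, which \<open>\<phi>\<close> moves.\<close>
  then show False using fun_cong[OF eq, of "(x, False)"] x y y_L
    by (auto simp: X_def \<phi>_def map_comp_def)
qed

text \<open>Right multiplication by \<open>u\<close> can be undone inside \<open>U\<close>: with
  \<open>x = y \<cdot> v\<close>, some \<open>w\<close> in \<open>U\<close> satisfies
  \<open>v \<cdot> u \<cdot> w = v\<close>, so \<open>x = x \<cdot> u \<cdot> w\<close>.\<close>

lemma U_if_mult_U:
  assumes "x \<in> J" "u \<in> U" "x \<cdot> u \<in> J" "x \<cdot> u \<in> U"
  shows "x \<in> U"
proof -
  obtain y v where yv: "x = y \<cdot> v" "y \<in> J" "v \<in> U" "v \<in> J"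
    using J_eq_J_mult_U assms by blast
  then have S: "y \<in> S" "v \<in> S" "u \<in> S" using assms J_in_S U_in_S by auto
  then have "v \<cdot> u \<in> J" using J_suffix[of v u y] yv assms by auto
  then obtain w where w: "w \<in> U" "v \<cdot> u \<cdot> w = v" using U_cancel_right yv assms by blast
  then have "x = (x \<cdot> u) \<cdot> w" using S yv U_in_S by (simp add: assoc closed)
  then show ?thesis using U_closed assms w by metis
qed

lemma J_mult_left_trivial:
  assumes c: "c \<in> J" and x: "x \<in> J" "x \<notin> U"
  shows "c \<cdot> x = x"
proof -
  define F where "F = {s \<in> S. Some d \<preceq> Some s}"
  have F_left: "s \<in> F" if "s \<cdot> t \<in> F" "s \<in> S" "t \<in> S" for s t
    using that J_le_trans[of "Some d" "Some (s \<cdot> t)" "Some s"] J_le_mult by (auto simp: F_def)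
  have F_right: "t \<in> F" if "s \<cdot> t \<in> F" "s \<in> S" "t \<in> S" for s t
    using that J_le_trans[of "Some d" "Some (s \<cdot> t)" "Some t"] J_le_mult by (auto simp: F_def)
  have F: "s \<in> U \<or> s \<in> J" if "s \<in> F" for s
    using that above_J[OF d_in_J] by (auto simp: F_def)
  have J_F: "s \<in> F" if "s \<in> J" for s
    using that by (auto simp: F_def J_class_def)
  have F_J: "s \<cdot> t \<in> J \<longleftrightarrow> s \<cdot> t \<in> F" if "s \<in> J" "t \<in> S" for s t
    using that J_F J_convex[OF d_in_J \<open>s \<in> J\<close>, of "s \<cdot> t"] J_le_mult
    by (auto simp: F_def)
  \<comment> \<open>Right translation, undefined where it leaves \<open>F\<close>;
    \<open>None\<close> is the adjoined identity.\<close>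
  define X where "X s p = (case p of None \<Rightarrow> if s \<in> F then Some (Some s) else None
    | Some y \<Rightarrow> if y \<in> F \<and> y \<cdot> s \<in> F then Some (Some (y \<cdot> s)) else None)" for s p
  define \<phi> where "\<phi> p = (case p of None \<Rightarrow> Some None
    | Some y \<Rightarrow> if y \<notin> F then None else Some (Some (if y \<in> U then y else c \<cdot> y)))" for p
  have FS: "s \<in> S" if "s \<in> F" for s using that by (simp add: F_def)
  have "X (s \<cdot> t) = X t \<circ>\<^sub>m X s" if "s \<in> S" "t \<in> S" for s t
    using that F_left[of s t] F_left[of "_ \<cdot> s" t] FS
    by (auto simp: X_def map_comp_def fun_eq_iff assoc closed split: option.splits)
  moreover have "\<phi> \<circ>\<^sub>m X u = X u \<circ>\<^sub>m \<phi>" if u: "u \<in> U" for u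
  proof
    fix p
    show "(\<phi> \<circ>\<^sub>m X u) p = (X u \<circ>\<^sub>m \<phi>) p"
    proof (cases p)
      case None
      then show ?thesis using u by (auto simp: X_def \<phi>_def map_comp_def)
    next
      case (Some y)
      consider "y \<notin> F" | "y \<in> F" "y \<in> U" | "y \<in> J" "y \<notin> U" using F by blast
      then show ?thesis
      proof cases
        case 3
        have S: "y \<in> S" "u \<in> S" "c \<in> S" using 3 u c J_in_S U_in_S by auto
        have cy: "c \<cdot> y \<in> J" using J_closed c 3 by blast
        have "c \<cdot> y \<cdot> u \<in> F \<longleftrightarrow> y \<cdot> u \<in> F"
        proof
          assume "c \<cdot> y \<cdot> u \<in> F"
          then show "y \<cdot> u \<in> F" using F_right[of c "y \<cdot> u"] S by (simp add: assoc closed)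
        next
          assume "y \<cdot> u \<in> F"
          then have "y \<cdot> u \<in> J" using F_J 3 S by blast
          then show "c \<cdot> y \<cdot> u \<in> F" using J_F[OF J_closed[OF c]] S by (simp add: assoc)
        qed
        \<comment> \<open>Hence \<open>\<phi>\<close> treats \<open>y\<close> and
          \<open>y \<cdot> u\<close> by the same rule.\<close>
        moreover have "y \<cdot> u \<notin> U" if "y \<cdot> u \<in> F"
          using U_if_mult_U[of y u] F_J[of y u] that 3 u S by blast
        ultimately show ?thesis
          using 3 J_F[OF cy] J_F[OF 3(1)] S by (simp add: X_def \<phi>_def map_comp_def Some assoc)
      qed (use u U_closed in \<open>auto simp: X_def \<phi>_def map_comp_def Some\<close>)
    qed
  qed
  ultimately have "\<phi> \<circ>\<^sub>m X x = X x \<circ>\<^sub>m \<phi>"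
    using equivariant[of X X \<phi> x] x J_in_S by blast
  \<comment> \<open>At the identity, one side gives \<open>c \<cdot> x\<close> and the other
    \<open>x\<close>.\<close>
  from fun_cong[OF this, of None] show ?thesis
    using x J_F by (auto simp: X_def \<phi>_def map_comp_def)
qed

lemma contradiction: False
proof -
  have dJ: "d \<in> J" "d \<notin> U" using d d_in_J by (auto simp: U_def)
  obtain y v where yv: "d = y \<cdot> v" "y \<in> J" "v \<in> U" "v \<in> J"
    using J_eq_J_mult_U dJ by blast
  then have S: "y \<in> S" "v \<in> S" using J_in_S by auto
  obtain w where w: "w \<in> U" "v \<cdot> v \<cdot> w = v"
    using U_cancel_right[of v v] J_closed yv by blast
  \<comment> \<open>Chosen in \<open>U\<close> and \<open>J\<close> as a right unit of
    \<open>v\<close>, hence also of \<open>d = y \<cdot> v\<close>.\<close>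
  define c where "c = v \<cdot> w"
  have wS: "w \<in> S" using w U_in_S by auto
  have vc: "v \<cdot> c = v" using w S wS by (simp add: c_def assoc)
  have cU: "c \<in> U" using yv w U_closed by (simp add: c_def)
  have cJ: "c \<in> J"
    using J_suffix[of v w v] w yv S wS by (simp add: c_def)
  have cS: "c \<in> S" using cJ J_in_S by auto
  have dd: "d \<cdot> d = d" and cd: "c \<cdot> d = d"
    using J_mult_left_trivial dJ cJ by auto
  have dc: "d \<cdot> c = d" using vc S cS by (simp add: yv(1) assoc)
  \<comment> \<open>From \<open>c \<cdot> d = d\<close>, \<open>t\<close> carries \<open>d\<close>
    to \<open>c\<close>; since \<open>d\<close> is idempotent,
    \<open>d \<cdot> c = c\<close>.\<close>
  obtain t where t: "t \<in> S1" "Some (c \<cdot> d) \<odot> t = Some c"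
    using J_cancel_right[of c d] cJ d cd d_in_J by auto
  then have "Some (d \<cdot> c) = Some c"
    using d dd cd mult1_assoc[of "Some d" "Some d" t] by simp
  then show False using dc cU dJ by simp
qed

end

theorem corollary3p2:
  fixes S :: "'s set" and f :: "'s \<Rightarrow> 's \<Rightarrow> 's"
    and T :: "'t set" and e :: "'t \<Rightarrow> 't \<Rightarrow> 't"
    and \<alpha> :: "'t \<Rightarrow> 's"
  assumes "DS S f"
    and "semigroup_on T e"
    and "semigroup_epi TYPE('r::infinite) T e S f \<alpha>"
  shows "\<alpha> ` T = S"
proof (rule ccontr)
  assume ne: "\<alpha> ` T \<noteq> S"
  interpret finite_semigroup_on S f
    using assms(1) by (auto simp: DS_def finite_semigroup_on_def finite_semigroup_on_axioms_def)
  \<comment> \<open>As \<open>J_le\<close> is only a preorder, maximality is taken among principal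
    ideals under inclusion.\<close>
  define below where "below x = {z \<in> S. J_le (Some z) (Some x)}" for x
  have "\<alpha> ` T \<subseteq> S"
    using assms(3) by (auto simp: semigroup_epi_def semigroup_hom_def)
  with ne have "below ` (S - \<alpha> ` T) \<noteq> {}" by blast
  then have "\<exists>B\<in>below ` (S - \<alpha> ` T). \<forall>C\<in>below ` (S - \<alpha> ` T). B \<subseteq> C \<longrightarrow> B = C"
    by (intro finite_has_maximal) (simp_all add: finite_carrier)
  then obtain d where d: "d \<in> S - \<alpha> ` T"
    and max: "\<And>y. y \<in> S - \<alpha> ` T \<Longrightarrow> below d \<subseteq> below y \<Longrightarrow> below d = below y"
    by (elim bexE imageE) force
  have "J_le (Some y) (Some d)" if y: "y \<in> S" "y \<notin> \<alpha> ` T" "J_le (Some d) (Some y)" for y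
  proof -
    have "below d \<subseteq> below y"
      using J_le_trans[OF _ y(3)] y by (auto simp: below_def)
    then have "below d = below y" using max y by blast
    moreover have "y \<in> below y" using y by (simp add: below_def)
    ultimately have "y \<in> below d" by simp
    then show ?thesis by (simp add: below_def)
  qed
  then interpret maximal_missing_J_class S f T e \<alpha> d
    using assms semigroup_epi_any_type[OF assms(3) countable_finite[OF finite_carrier]] d
    by (intro maximal_missing_J_class.intro maximal_missing_J_class_axioms.intro
      finite_semigroup_on_axioms) auto
  show False by (rule contradiction)
qed

end
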